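(* Suppose the algorithms ADSG I and ADSG II (both described in the context) are run with the same input (and the same realizations of the random choices of mini-batches $I$, blocks $l$ and indices $\sigma$). Then the iterates $\mathbf{x}_k,\mathbf{y}_k,\mathbf{z}_k$ of ADSG I equal, respectively, the vectors $\bar{\mathbf{x}}_k,\bar{\mathbf{y}}_k,\bar{\mathbf{z}}_k$ associated with ADSG II, for all $k$.
   Context: Problem: minimize $\mathbf{F}(\mathbf{x})+\mathbf{P}(\mathbf{x})$ over $\mathbb{R}^d$, where $\mathbf{F}=\frac1n\sum_{i=1}^nf_i$ with $f_i$ convex and differentiable (with smoothness constant $L$ and block-smoothness constant $L_B$), and $\mathbf{P}(\mathbf{x})=\sum_{l=1}^B\mathbf{P}_l([\mathbf{x}]_l)$ convex. The coordinates are partitioned into $B$ equal blocks; $[\mathbf{x}]_l$ is the $l$-th block and $[\mathbf{x}]_{\backslash l}$ the remaining coordinates. $\mathrm{prox}_g(\mathbf{y})=\mathrm{argmin}_{\mathbf{x}}\, g(\mathbf{x})+\frac12\|\mathbf{x}-\mathbf{y}\|^2$. Common input: $n,\mathbf{x}_0,S,b,B,\mu\ge0$ and positive weights $\alpha_{2,s},\alpha_{3,s}$ ($0\le s\le S$) with $\alpha_{1,s}=1-\alpha_{2,s}-\alpha_{3,s}>0$. Put $m=Bn$, $\bar L_s=\frac{L}{B\alpha_{3,s}}+L_B$, $\eta_s=\frac1{\bar L_s\alpha_{2,s}B}$, $\theta_s=1+\frac{\mu}{\bar L_sB^2\alpha_{2,s}+(B-1)\mu}$. ADSG I: $\mathbf{z}_0=\tilde{\mathbf{x}}^0=\mathbf{x}_0$.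 For $s=0,\dots,S$: for $j=1,\dots,m$, with $k=sm+j$: $\mathbf{y}_k=\alpha_{1,s}\mathbf{x}_{k-1}+\alpha_{2,s}\mathbf{z}_{k-1}+\alpha_{3,s}\tilde{\mathbf{x}}^s$; sample a mini-batch $I$ of size $b$ and a block $l$; $[\mathbf{v}_k]_l=[\nabla\mathbf{F}(\tilde{\mathbf{x}}^s)]_l+\frac1b\sum_{i\in I}([\nabla f_i(\mathbf{y}_k)]_l-[\nabla f_i(\tilde{\mathbf{x}}^s)]_l)$; $[\mathbf{z}_k]_l=\mathrm{prox}_{\eta_s\mathbf{P}_l}([\mathbf{z}_{k-1}]_l-\eta_s[\mathbf{v}_k]_l)$, $[\mathbf{z}_k]_{\backslash l}=[\mathbf{z}_{k-1}]_{\backslash l}$; $\mathbf{x}_k=\mathbf{y}_k+\alpha_{2,s}B(\mathbf{z}_k-\mathbf{z}_{k-1})$. Then sample $\sigma\in\{1,\dots,m\}$ with probability $\theta_s^{\sigma-1}/\sum_{i=0}^{m-1}\theta_s^i$; set $\tilde{\mathbf{x}}^{s+1}=\mathbf{x}_{sm+\sigma}$. ADSG II: $\hat{\mathbf{z}}_0^0=0$, $\xi=\dot{\mathbf{x}}^0=\mathbf{x}_0$. For $s=0,\dots,S$: set $\gamma_s=\frac{\alpha_{2,s}}{\alpha_{2,s}+\alpha_{3,s}}$, $\beta_{-1}^s=1$, $\beta_0^s=\alpha_{1,s}$, $\mathbf{u}_0^s=\xi-\gamma_s\hat{\mathbf{z}}_0^s-\dot{\mathbf{x}}^s$. For $j=1,\dots,m$,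 with $k=sm+j$: sample a mini-batch $I$ of size $b$ and a block $l$; $[\dot{\mathbf{v}}_k]_l=[\nabla\mathbf{F}(\dot{\mathbf{x}}^s)]_l+\frac1b\sum_{i\in I}([\nabla f_i(\bar{\mathbf{y}}_k)]_l-[\nabla f_i(\dot{\mathbf{x}}^s)]_l)$; $[\hat{\mathbf{z}}_j^s]_l=\mathrm{prox}_{\eta_s\mathbf{P}_l}([\bar{\mathbf{z}}_{k-1}]_l-\eta_s[\dot{\mathbf{v}}_k]_l)-[\dot{\mathbf{x}}^s]_l$, $[\hat{\mathbf{z}}_j^s]_{\backslash l}=[\hat{\mathbf{z}}_{j-1}^s]_{\backslash l}$; $\mathbf{u}_j^s=\mathbf{u}_{j-1}^s+\frac{\alpha_{2,s}B-\gamma_s}{\beta_{j-1}^s}(\hat{\mathbf{z}}_j^s-\hat{\mathbf{z}}_{j-1}^s)$; $\beta_j^s=\alpha_{1,s}\beta_{j-1}^s$. After the inner loop (so $k=(s+1)m$): sample $\sigma$ as in ADSG I, set $\dot{\mathbf{x}}^{s+1}=\bar{\mathbf{x}}_{sm+\sigma}$, $\hat{\mathbf{z}}_0^{s+1}=\bar{\mathbf{z}}_k-\dot{\mathbf{x}}^{s+1}$, $\xi=\bar{\mathbf{x}}_k$. Associated vectors, for $k=sm+j$ with $1\le j\le m$: $\bar{\mathbf{y}}_k=\beta_{j-1}^s\mathbf{u}_{j-1}^s+\gamma_s\hat{\mathbf{z}}_{j-1}^s+\dot{\mathbf{x}}^s$, $\bar{\mathbf{z}}_k=\hat{\mathbf{z}}_j^s+\dot{\mathbf{x}}^s$,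 $\bar{\mathbf{x}}_k=\beta_{j-1}^s\mathbf{u}_j^s+\gamma_s\hat{\mathbf{z}}_j^s+\dot{\mathbf{x}}^s$; and for $k=0$ (i.e. $s=j=0$) $\bar{\mathbf{z}}_0=\hat{\mathbf{z}}_0^0+\dot{\mathbf{x}}^0$, $\bar{\mathbf{x}}_0=\beta_{-1}^0\mathbf{u}_0^0+\gamma_0\hat{\mathbf{z}}_0^0+\dot{\mathbf{x}}^0$. *)

theory Defs
  imports "HOL-Analysis.Analysis" "HOL-Library.Multiset"
begin

text \<open>
  The space of dimension \<open>d\<close>, with its coordinates partitioned into \<open>B\<close> equal blocks, is the type
  \<open>real ^ 'c ^ 'b\<close> with \<open>B = CARD('b)\<close> and \<open>d = CARD('b) * CARD('c)\<close>: the block \<open>[x]\<^sub>l\<close> is \<open>x $ l\<close>.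
  The norm of this type is the Euclidean norm of all \<open>d\<close> coordinates.
\<close>

definition gradient :: "('a::real_inner \<Rightarrow> real) \<Rightarrow> 'a \<Rightarrow> 'a" where
  "gradient f x = (THE D. GDERIV f x :> D)"

definition prox :: "('a::real_normed_vector \<Rightarrow> real) \<Rightarrow> 'a \<Rightarrow> 'a" where
  "prox g y = arg_min (\<lambda>x. g x + 1/2 * (norm (x - y))\<^sup>2) (\<lambda>_. True)"

definition average :: "nat \<Rightarrow> (nat \<Rightarrow> 'a \<Rightarrow> real) \<Rightarrow> 'a \<Rightarrow> real" where
  "average n f x = 1 / real n * (\<Sum>i = 1..n. f i x)"

definition block_smooth :: "real \<Rightarrow> (real ^ 'c ^ 'b \<Rightarrow> real) \<Rightarrow> bool" where
  "block_smooth L\<^sub>B f \<longleftrightarrow>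
     (\<forall>l x y. (\<forall>l'. l' \<noteq> l \<longrightarrow> x $ l' = y $ l') \<longrightarrow>
        norm (gradient f x $ l - gradient f y $ l) \<le> L\<^sub>B * norm (x $ l - y $ l))"

definition Lbar :: "real \<Rightarrow> real \<Rightarrow> nat \<Rightarrow> real \<Rightarrow> real" where
  "Lbar L L\<^sub>B B a\<^sub>3 = L / (real B * a\<^sub>3) + L\<^sub>B"

definition step_size :: "real \<Rightarrow> real \<Rightarrow> nat \<Rightarrow> real \<Rightarrow> real \<Rightarrow> real" where
  "step_size L L\<^sub>B B a\<^sub>2 a\<^sub>3 = 1 / (Lbar L L\<^sub>B B a\<^sub>3 * a\<^sub>2 * real B)"

definition growth_factor :: "real \<Rightarrow> real \<Rightarrow> nat \<Rightarrow> real \<Rightarrow> real \<Rightarrow> real \<Rightarrow> real" where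
  "growth_factor L L\<^sub>B B \<mu> a\<^sub>2 a\<^sub>3 =
     1 + \<mu> / (Lbar L L\<^sub>B B a\<^sub>3 * (real B)\<^sup>2 * a\<^sub>2 + (real B - 1) * \<mu>)"

definition index_prob :: "real \<Rightarrow> nat \<Rightarrow> nat \<Rightarrow> real" where
  "index_prob \<theta> m i = (if i \<in> {1..m} then \<theta> ^ (i - 1) / (\<Sum>t = 0..m-1. \<theta> ^ t) else 0)"

text \<open>
  Block \<open>l\<close> of the variance-reduced gradient at \<open>y\<close> with snapshot \<open>w\<close>. A mini-batch is a multiset,
  which covers sampling both with and without replacement.
\<close>

definition vr_gradient_block ::
  "nat \<Rightarrow> (nat \<Rightarrow> real ^ 'c ^ 'b \<Rightarrow> real) \<Rightarrow> nat \<Rightarrow> nat multiset \<Rightarrow> 'b \<Rightarrow>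
   real ^ 'c ^ 'b \<Rightarrow> real ^ 'c ^ 'b \<Rightarrow> real ^ 'c" where
  "vr_gradient_block n f b I l w y =
     gradient (average n f) w $ l
     + (1 / real b) *\<^sub>R (\<Sum>i\<in>#I. gradient (f i) y $ l - gradient (f i) w $ l)"

text \<open>
  The two predicates below say that the given sequences are produced by a run of the algorithm in
  which the mini-batch and the block of iteration \<open>k\<close> are \<open>I k\<close> and \<open>l k\<close>, and the index drawn at the
  end of outer iteration \<open>s\<close> is \<open>\<sigma> s\<close>. The sequence \<open>w\<close> holds the snapshots
  (\<open>x\<close> with a tilde in ADSG I, with a dot in ADSG II).
\<close>

definition ADSG_I ::
  "(nat \<Rightarrow> real ^ 'c ^ 'b \<Rightarrow> real) \<Rightarrow> ('b \<Rightarrow> real ^ 'c \<Rightarrow> real) \<Rightarrow>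
   nat \<Rightarrow> real ^ 'c ^ 'b \<Rightarrow> nat \<Rightarrow> nat \<Rightarrow> nat \<Rightarrow>
   (nat \<Rightarrow> real) \<Rightarrow> (nat \<Rightarrow> real) \<Rightarrow> (nat \<Rightarrow> real) \<Rightarrow> (nat \<Rightarrow> real) \<Rightarrow>
   (nat \<Rightarrow> nat multiset) \<Rightarrow> (nat \<Rightarrow> 'b) \<Rightarrow> (nat \<Rightarrow> nat) \<Rightarrow>
   (nat \<Rightarrow> real ^ 'c ^ 'b) \<Rightarrow> (nat \<Rightarrow> real ^ 'c ^ 'b) \<Rightarrow> (nat \<Rightarrow> real ^ 'c ^ 'b) \<Rightarrow>
   (nat \<Rightarrow> real ^ 'c ^ 'b) \<Rightarrow> bool" where
  "ADSG_I f P n x\<^sub>0 S b B \<alpha>\<^sub>1 \<alpha>\<^sub>2 \<alpha>\<^sub>3 \<eta> I l \<sigma> x y z w \<longleftrightarrow>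
     x 0 = x\<^sub>0 \<and> z 0 = x\<^sub>0 \<and> w 0 = x\<^sub>0 \<and>
     (\<forall>s\<le>S.
        (\<forall>j\<in>{1..B * n}. let k = s * (B * n) + j in
           y k = \<alpha>\<^sub>1 s *\<^sub>R x (k - 1) + \<alpha>\<^sub>2 s *\<^sub>R z (k - 1) + \<alpha>\<^sub>3 s *\<^sub>R w s \<and>
           z k $ l k = prox (\<lambda>v. \<eta> s * P (l k) v)
             (z (k - 1) $ l k - \<eta> s *\<^sub>R vr_gradient_block n f b (I k) (l k) (w s) (y k)) \<and>
           (\<forall>l'. l' \<noteq> l k \<longrightarrow> z k $ l' = z (k - 1) $ l') \<and>
           x k = y k + (\<alpha>\<^sub>2 s * real B) *\<^sub>R (z k - z (k - 1))) \<and>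
        w (Suc s) = x (s * (B * n) + \<sigma> s))"

text \<open>
  In the second algorithm \<open>zhat s j\<close>, \<open>u s j\<close> and \<open>\<beta> s j\<close> carry the outer iteration \<open>s\<close> as a
  superscript, and \<open>\<xi> s\<close> is the value of the variable \<open>\<xi>\<close> at the start of outer iteration \<open>s\<close>.
  The second argument of \<open>\<beta>\<close> is an integer because it starts at \<open>- 1\<close>.
\<close>

definition ADSG_II ::
  "(nat \<Rightarrow> real ^ 'c ^ 'b \<Rightarrow> real) \<Rightarrow> ('b \<Rightarrow> real ^ 'c \<Rightarrow> real) \<Rightarrow>
   nat \<Rightarrow> real ^ 'c ^ 'b \<Rightarrow> nat \<Rightarrow> nat \<Rightarrow> nat \<Rightarrow>
   (nat \<Rightarrow> real) \<Rightarrow> (nat \<Rightarrow> real) \<Rightarrow> (nat \<Rightarrow> real) \<Rightarrow> (nat \<Rightarrow> real) \<Rightarrow>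
   (nat \<Rightarrow> nat multiset) \<Rightarrow> (nat \<Rightarrow> 'b) \<Rightarrow> (nat \<Rightarrow> nat) \<Rightarrow>
   (nat \<Rightarrow> nat \<Rightarrow> real ^ 'c ^ 'b) \<Rightarrow> (nat \<Rightarrow> nat \<Rightarrow> real ^ 'c ^ 'b) \<Rightarrow>
   (nat \<Rightarrow> int \<Rightarrow> real) \<Rightarrow> (nat \<Rightarrow> real) \<Rightarrow> (nat \<Rightarrow> real ^ 'c ^ 'b) \<Rightarrow>
   (nat \<Rightarrow> real ^ 'c ^ 'b) \<Rightarrow> (nat \<Rightarrow> real ^ 'c ^ 'b) \<Rightarrow> (nat \<Rightarrow> real ^ 'c ^ 'b) \<Rightarrow>
   (nat \<Rightarrow> real ^ 'c ^ 'b) \<Rightarrow> bool" where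
  "ADSG_II f P n x\<^sub>0 S b B \<alpha>\<^sub>1 \<alpha>\<^sub>2 \<alpha>\<^sub>3 \<eta> I l \<sigma> zhat u \<beta> \<gamma> \<xi> xbar ybar zbar w \<longleftrightarrow>
     zhat 0 0 = 0 \<and> \<xi> 0 = x\<^sub>0 \<and> w 0 = x\<^sub>0 \<and>
     zbar 0 = zhat 0 0 + w 0 \<and>
     xbar 0 = \<beta> 0 (- 1) *\<^sub>R u 0 0 + \<gamma> 0 *\<^sub>R zhat 0 0 + w 0 \<and>
     (\<forall>s\<le>S.
        \<gamma> s = \<alpha>\<^sub>2 s / (\<alpha>\<^sub>2 s + \<alpha>\<^sub>3 s) \<and>
        \<beta> s (- 1) = 1 \<and>
        \<beta> s 0 = \<alpha>\<^sub>1 s \<and>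
        u s 0 = \<xi> s - \<gamma> s *\<^sub>R zhat s 0 - w s \<and>
        (\<forall>j\<in>{1..B * n}. let k = s * (B * n) + j in
           ybar k = \<beta> s (int j - 1) *\<^sub>R u s (j - 1) + \<gamma> s *\<^sub>R zhat s (j - 1) + w s \<and>
           zhat s j $ l k = prox (\<lambda>v. \<eta> s * P (l k) v)
             (zbar (k - 1) $ l k - \<eta> s *\<^sub>R vr_gradient_block n f b (I k) (l k) (w s) (ybar k))
             - w s $ l k \<and>
           (\<forall>l'. l' \<noteq> l k \<longrightarrow> zhat s j $ l' = zhat s (j - 1) $ l') \<and>
           u s j = u s (j - 1)
             + ((\<alpha>\<^sub>2 s * real B - \<gamma> s) / \<beta> s (int j - 1)) *\<^sub>R (zhat s j - zhat s (j - 1)) \<and>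
           \<beta> s (int j) = \<alpha>\<^sub>1 s * \<beta> s (int j - 1) \<and>
           zbar k = zhat s j + w s \<and>
           xbar k = \<beta> s (int j - 1) *\<^sub>R u s j + \<gamma> s *\<^sub>R zhat s j + w s) \<and>
        w (Suc s) = xbar (s * (B * n) + \<sigma> s) \<and>
        zhat (Suc s) 0 = zbar (Suc s * (B * n)) - w (Suc s) \<and>
        \<xi> (Suc s) = xbar (Suc s * (B * n)))"

end

theory Submission
  imports Defs
begin

text \<open>
  Within outer iteration \<open>s\<close> the quantities of ADSG II are coordinates for the iterates of ADSG I:
  \<open>z = zhat + w\<close> and \<open>x = \<beta> u + \<gamma> zhat + w\<close>. Since \<open>\<gamma> = \<alpha>\<^sub>1 \<gamma> + \<alpha>\<^sub>2\<close>, the convex combination defining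
  \<open>y\<close> acts on these coordinates by multiplying \<open>\<beta>\<close> by \<open>\<alpha>\<^sub>1\<close>, and the update of \<open>u\<close> is exactly what the
  extrapolation step in \<open>x\<close> requires. Between outer iterations the new \<open>zhat\<close> and \<open>u\<close> re-express the
  same \<open>x\<close> and \<open>z\<close> relative to the new snapshot.
\<close>

text \<open>\<open>g\<close> is the fixed point of the map taking t to
  \<open>a\<^sub>1 * t + a\<^sub>2\<close>, because
  \<open>1 - a\<^sub>1 = a\<^sub>2 + a\<^sub>3\<close>; so the coefficient of \<open>h\<close>
  survives the averaging. That of \<open>w\<close> survives because the weights sum to one, and only
  \<open>u\<close> is rescaled.\<close>

lemma coupling_step:
  fixes u h w :: "'a::real_vector"
  assumes "a\<^sub>1 = 1 - a\<^sub>2 - a\<^sub>3" and "a\<^sub>2 + a\<^sub>3 \<noteq> 0" and "g = a\<^sub>2 / (a\<^sub>2 + a\<^sub>3)"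
  shows "a\<^sub>1 *\<^sub>R (c *\<^sub>R u + g *\<^sub>R h + w) + a\<^sub>2 *\<^sub>R (h + w) + a\<^sub>3 *\<^sub>R w =
    (a\<^sub>1 * c) *\<^sub>R u + g *\<^sub>R h + w"
proof -
  have "g * (a\<^sub>2 + a\<^sub>3) = a\<^sub>2"
    using assms(2,3) by simp
  then have "a\<^sub>1 * g + a\<^sub>2 = g"
    unfolding assms(1) by (simp add: algebra_simps)
  moreover have "a\<^sub>1 + a\<^sub>2 + a\<^sub>3 = 1"
    using assms(1) by simp
  moreover have "a\<^sub>1 *\<^sub>R (c *\<^sub>R u + g *\<^sub>R h + w) + a\<^sub>2 *\<^sub>R (h + w) + a\<^sub>3 *\<^sub>R w =
      (a\<^sub>1 * c) *\<^sub>R u + (a\<^sub>1 * g + a\<^sub>2) *\<^sub>R h + (a\<^sub>1 + a\<^sub>2 + a\<^sub>3) *\<^sub>R w"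
    by (simp add: scaleR_add_left scaleR_add_right)
  ultimately show ?thesis
    by simp
qed

text \<open>The outer factor \<open>c\<close> cancels the division in the increment of
  \<open>u\<close>, and the \<open>- g\<close> in that increment pays for replacing
  \<open>g *\<^sub>R h\<close> by \<open>g *\<^sub>R h'\<close>.\<close>

lemma extrapolation_step:
  fixes u h h' :: "'a::real_vector"
  assumes "c \<noteq> 0"
  shows "c *\<^sub>R (u + ((t - g) / c) *\<^sub>R (h' - h)) + g *\<^sub>R h' = c *\<^sub>R u + g *\<^sub>R h + t *\<^sub>R (h' - h)"
proof -
  have "c *\<^sub>R (((t - g) / c) *\<^sub>R (h' - h)) = (t - g) *\<^sub>R (h' - h)"
    using assms by simp
  then show ?thesis
    unfolding scaleR_add_right by (simp add: algebra_simps)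
qed

theorem proposition1:
  fixes f :: "nat \<Rightarrow> real ^ 'c ^ 'b \<Rightarrow> real"
    and P :: "'b \<Rightarrow> real ^ 'c \<Rightarrow> real"
    and L L\<^sub>B \<mu> :: real
    and n S b B :: nat
    and x\<^sub>0 :: "real ^ 'c ^ 'b"
    and \<alpha>\<^sub>1 \<alpha>\<^sub>2 \<alpha>\<^sub>3 \<eta> \<theta> :: "nat \<Rightarrow> real"
    and I :: "nat \<Rightarrow> nat multiset"
    and l :: "nat \<Rightarrow> 'b"
    and \<sigma> :: "nat \<Rightarrow> nat"
    and x y z w xbar ybar zbar w' \<xi> :: "nat \<Rightarrow> real ^ 'c ^ 'b"
    and zhat u :: "nat \<Rightarrow> nat \<Rightarrow> real ^ 'c ^ 'b"
    and \<beta> :: "nat \<Rightarrow> int \<Rightarrow> real"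
    and \<gamma> :: "nat \<Rightarrow> real"
  assumes "B = CARD('b)" and "n \<ge> 1" and "b \<ge> 1" and "\<mu> \<ge> 0"
    and "\<forall>i\<in>{1..n}. convex_on UNIV (f i)"
    and "\<forall>i\<in>{1..n}. f i differentiable_on UNIV"
    and "\<forall>i\<in>{1..n}. L-lipschitz_on UNIV (gradient (f i))"
    and "\<forall>i\<in>{1..n}. block_smooth L\<^sub>B (f i)"
    and "L \<ge> 0" and "L\<^sub>B \<ge> 0" and "L + L\<^sub>B > 0"
    and "convex_on UNIV (\<lambda>v. \<Sum>l\<in>UNIV. P l (v $ l))"
    and "\<forall>s\<le>S. \<alpha>\<^sub>2 s > 0 \<and> \<alpha>\<^sub>3 s > 0 \<and> \<alpha>\<^sub>1 s = 1 - \<alpha>\<^sub>2 s - \<alpha>\<^sub>3 s \<and> \<alpha>\<^sub>1 s > 0"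
    and "\<forall>s\<le>S. \<eta> s = step_size L L\<^sub>B B (\<alpha>\<^sub>2 s) (\<alpha>\<^sub>3 s)"
    and "\<forall>s\<le>S. \<theta> s = growth_factor L L\<^sub>B B \<mu> (\<alpha>\<^sub>2 s) (\<alpha>\<^sub>3 s)"
    and "\<forall>k\<in>{1..Suc S * (B * n)}. size (I k) = b \<and> set_mset (I k) \<subseteq> {1..n}"
    and "\<forall>s\<le>S. index_prob (\<theta> s) (B * n) (\<sigma> s) > 0"
    and "ADSG_I f P n x\<^sub>0 S b B \<alpha>\<^sub>1 \<alpha>\<^sub>2 \<alpha>\<^sub>3 \<eta> I l \<sigma> x y z w"
    and "ADSG_II f P n x\<^sub>0 S b B \<alpha>\<^sub>1 \<alpha>\<^sub>2 \<alpha>\<^sub>3 \<eta> I l \<sigma> zhat u \<beta> \<gamma> \<xi> xbar ybar zbar w'"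
  shows "(\<forall>k\<le>Suc S * (B * n). x k = xbar k \<and> z k = zbar k) \<and>
         (\<forall>k\<in>{1..Suc S * (B * n)}. y k = ybar k)"
proof -
  define m where "m = B * n"
  note weights = assms(13)
  have I_init: "x 0 = x\<^sub>0" "z 0 = x\<^sub>0" "w 0 = x\<^sub>0"
    using assms(18) unfolding ADSG_I_def by blast+
  have I_step:
    "y (s * m + j) = \<alpha>\<^sub>1 s *\<^sub>R x (s * m + j - 1) + \<alpha>\<^sub>2 s *\<^sub>R z (s * m + j - 1) + \<alpha>\<^sub>3 s *\<^sub>R w s"
    "z (s * m + j) $ l (s * m + j) = prox (\<lambda>v. \<eta> s * P (l (s * m + j)) v)
       (z (s * m + j - 1) $ l (s * m + j) - \<eta> s *\<^sub>R vr_gradient_block n f b (I (s * m + j))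
          (l (s * m + j)) (w s) (y (s * m + j)))"
    "l' \<noteq> l (s * m + j) \<Longrightarrow> z (s * m + j) $ l' = z (s * m + j - 1) $ l'"
    "x (s * m + j) = y (s * m + j) + (\<alpha>\<^sub>2 s * real B) *\<^sub>R (z (s * m + j) - z (s * m + j - 1))"
    if "s \<le> S" "j \<in> {1..m}" for s j l'
    using assms(18)[unfolded ADSG_I_def Let_def, folded m_def] that by auto
  have I_snapshot: "w (Suc s) = x (s * m + \<sigma> s)" if "s \<le> S" for s
    using assms(18) that unfolding ADSG_I_def m_def by blast
  have II_init: "zhat 0 0 = 0" "\<xi> 0 = x\<^sub>0" "w' 0 = x\<^sub>0" "zbar 0 = zhat 0 0 + w' 0"
    "xbar 0 = \<beta> 0 (- 1) *\<^sub>R u 0 0 + \<gamma> 0 *\<^sub>R zhat 0 0 + w' 0"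
    using assms(19) unfolding ADSG_II_def by blast+
  have II_start: "\<gamma> s = \<alpha>\<^sub>2 s / (\<alpha>\<^sub>2 s + \<alpha>\<^sub>3 s)" "\<beta> s (- 1) = 1" "\<beta> s 0 = \<alpha>\<^sub>1 s"
    "u s 0 = \<xi> s - \<gamma> s *\<^sub>R zhat s 0 - w' s"
    if "s \<le> S" for s
    using assms(19) that unfolding ADSG_II_def by blast+
  have II_step:
    "ybar (s * m + j) = \<beta> s (int j - 1) *\<^sub>R u s (j - 1) + \<gamma> s *\<^sub>R zhat s (j - 1) + w' s"
    "zhat s j $ l (s * m + j) = prox (\<lambda>v. \<eta> s * P (l (s * m + j)) v)
       (zbar (s * m + j - 1) $ l (s * m + j) - \<eta> s *\<^sub>R vr_gradient_block n f b (I (s * m + j))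
          (l (s * m + j)) (w' s) (ybar (s * m + j))) - w' s $ l (s * m + j)"
    "l' \<noteq> l (s * m + j) \<Longrightarrow> zhat s j $ l' = zhat s (j - 1) $ l'"
    "u s j = u s (j - 1)
       + ((\<alpha>\<^sub>2 s * real B - \<gamma> s) / \<beta> s (int j - 1)) *\<^sub>R (zhat s j - zhat s (j - 1))"
    "\<beta> s (int j) = \<alpha>\<^sub>1 s * \<beta> s (int j - 1)"
    "zbar (s * m + j) = zhat s j + w' s"
    "xbar (s * m + j) = \<beta> s (int j - 1) *\<^sub>R u s j + \<gamma> s *\<^sub>R zhat s j + w' s"
    if "s \<le> S" "j \<in> {1..m}" for s j l'
    using assms(19)[unfolded ADSG_II_def Let_def, folded m_def] that by auto
  have II_end: "w' (Suc s) = xbar (s * m + \<sigma> s)" "zhat (Suc s) 0 = zbar (Suc s * m) - w' (Suc s)"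
    "\<xi> (Suc s) = xbar (Suc s * m)"
    if "s \<le> S" for s
    using assms(19) that unfolding ADSG_II_def m_def by blast+

  \<comment> \<open>The update of \<open>u\<close> divides by these numbers. The index is shifted by
    one so that the induction starts at \<open>\<beta> s (- 1)\<close>; the bound
    \<open>Suc m\<close> reaches \<open>\<beta> s (int m)\<close>.\<close>
  have \<beta>_pos: "\<beta> s (int j - 1) > 0" if "s \<le> S" "j \<le> Suc m" for s j
    using that(2)
  proof (induction j)
    case 0
    then show ?case using II_start(2)[OF that(1)] by simp
  next
    case (Suc j)
    then show ?case
      using II_start(3)[OF that(1)] II_step(5)[OF that(1), of j] weights that(1)
      by (cases "j = 0") auto
  qed

  \<comment> \<open>The algorithm imposes the recurrence from j = 1 on; the starting value
    \<open>\<beta> s (- 1) = 1\<close> extends it to j = 0, so the first inner iteration needs no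
    special treatment.\<close>
  have \<beta>_rec: "\<beta> s (int j) = \<alpha>\<^sub>1 s * \<beta> s (int j - 1)" if "s \<le> S" "j \<le> m" for s j
    using II_start(2,3)[OF that(1)] II_step(5)[OF that(1), of j] that(2)
    by (cases "j = 0") auto

  \<comment> \<open>The coordinate forms of \<open>zbar\<close> and \<open>x\<close> are hypotheses
    because at j = 0 they do not come from an inner iteration of \<open>s\<close> but from the
    handover between outer iterations.\<close>
  have step:
    "y (s * m + Suc j) = ybar (s * m + Suc j)"
    "z (s * m + Suc j) = zbar (s * m + Suc j)"
    "x (s * m + Suc j) = xbar (s * m + Suc j)"
    if s: "s \<le> S" and j: "j < m" and w: "w s = w' s"
      and z: "z (s * m + j) = zbar (s * m + j)" "zbar (s * m + j) = zhat s j + w' s"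
      and x: "x (s * m + j) = \<beta> s (int j - 1) *\<^sub>R u s j + \<gamma> s *\<^sub>R zhat s j + w' s"
    for s j
  proof -
    let ?k = "s * m + Suc j"
    have j': "Suc j \<in> {1..m}" and pred: "?k - 1 = s * m + j"
      using j by auto
    note I = I_step[OF s j', unfolded pred] and II = II_step[OF s j', unfolded pred]
    have "y ?k = \<alpha>\<^sub>1 s *\<^sub>R (\<beta> s (int j - 1) *\<^sub>R u s j + \<gamma> s *\<^sub>R zhat s j + w' s)
        + \<alpha>\<^sub>2 s *\<^sub>R (zhat s j + w' s) + \<alpha>\<^sub>3 s *\<^sub>R w' s"
      using I(1) w x z by simp
    also have "\<dots> = (\<alpha>\<^sub>1 s * \<beta> s (int j - 1)) *\<^sub>R u s j + \<gamma> s *\<^sub>R zhat s j + w' s"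
    proof (rule coupling_step)
      have "\<alpha>\<^sub>2 s > 0" "\<alpha>\<^sub>3 s > 0"
        using weights s by blast+
      then show "\<alpha>\<^sub>2 s + \<alpha>\<^sub>3 s \<noteq> 0"
        by linarith
    qed (use weights s II_start(1) in auto)
    also have "\<dots> = ybar ?k"
      using II(1) \<beta>_rec[OF s, of j] j by simp
    finally show y: "y ?k = ybar ?k" .
    \<comment> \<open>On the sampled block the two prox arguments agree, since the gradient points
      \<open>y ?k\<close> and \<open>ybar ?k\<close> do, and adding \<open>w' s\<close> undoes the
      shift in \<open>zhat\<close>. The other blocks are frozen in both algorithms.\<close>
    show z': "z ?k = zbar ?k"
    proof (subst vec_eq_iff, intro allI)
      fix l'
      show "z ?k $ l' = zbar ?k $ l'"
        using I(2,3) II(2,3,6) w y z by (cases "l' = l ?k") auto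
    qed
    have "x ?k = ybar ?k + (\<alpha>\<^sub>2 s * real B) *\<^sub>R (zhat s (Suc j) - zhat s j)"
      using I(4) II(6) y z z' by simp
    \<comment> \<open>Both \<open>ybar ?k\<close> and \<open>xbar ?k\<close> carry the factor
      \<open>\<beta> s (int j)\<close>, which is also the divisor in the update of \<open>u\<close>;
      its positivity is \<open>\<beta>_pos\<close> at \<open>Suc j\<close>.\<close>
    also have "\<dots> = xbar ?k"
      using II(1,4,7) \<beta>_pos[OF s, of "Suc j"] j
        extrapolation_step[of "\<beta> s (int j)" "u s j" "\<alpha>\<^sub>2 s * real B" "\<gamma> s" "zhat s (Suc j)" "zhat s j"]
      by simp
    finally show "x ?k = xbar ?k" .
  qed

  have inner: "z (s * m + j) = zbar (s * m + j) \<and> x (s * m + j) = xbar (s * m + j) \<and>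
      zbar (s * m + j) = zhat s j + w' s \<and>
      xbar (s * m + j) = \<beta> s (int j - 1) *\<^sub>R u s j + \<gamma> s *\<^sub>R zhat s j + w' s"
    if s: "s \<le> S" and j: "j \<le> m" and w: "w s = w' s"
      and "z (s * m) = zbar (s * m)" "zbar (s * m) = zhat s 0 + w' s"
      and "x (s * m) = xbar (s * m)" "xbar (s * m) = \<xi> s"
    for s j
    using j
  proof (induction j)
    case 0
    \<comment> \<open>With \<open>\<beta> s (- 1) = 1\<close>, the definition of
      \<open>u s 0\<close> makes the coordinate form collapse to \<open>\<xi> s\<close>.\<close>
    then show ?case using that II_start by simp
  next
    case (Suc j)
    then show ?case using step[OF s _ w, of j] II_step(6,7)[OF s, of "Suc j"] by simp
  qed

  \<comment> \<open>An index of positive probability lies in \<open>{1..m}\<close>, so the snapshot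
    is one of the iterates that \<open>inner\<close> compares.\<close>
  have \<sigma>: "\<sigma> s \<le> m" if "s \<le> S" for s
    using assms(17) that unfolding index_prob_def m_def by (force split: if_splits)

  have outer: "w s = w' s \<and> z (s * m) = zbar (s * m) \<and> zbar (s * m) = zhat s 0 + w' s \<and>
      x (s * m) = xbar (s * m) \<and> xbar (s * m) = \<xi> s"
    if "s \<le> Suc S" for s
    using that
  proof (induction s)
    case 0
    then show ?case using I_init II_init II_start[of 0] by simp
  next
    case (Suc s)
    then have s: "s \<le> S" by simp
    with Suc have IH: "w s = w' s" "z (s * m) = zbar (s * m)" "zbar (s * m) = zhat s 0 + w' s"
      "x (s * m) = xbar (s * m)" "xbar (s * m) = \<xi> s"
      by auto
    have last: "Suc s * m = s * m + m" by simp
    show ?case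
      \<comment> \<open>The instance at \<open>\<sigma> s\<close> makes the new snapshots equal; the
        instance at j = m transfers the final \<open>x\<close> and \<open>z\<close>, which
        \<open>II_end\<close> rewrites relative to the new snapshot.\<close>
      using inner[OF s \<sigma>[OF s] IH] inner[OF s order_refl IH] I_snapshot[OF s] II_end[OF s]
      unfolding last by simp
  qed

  have all: "x (s * m + j) = xbar (s * m + j)" "z (s * m + j) = zbar (s * m + j)"
    if "s \<le> S" "j \<le> m" for s j
    using inner[OF that] outer[of s] that(1) by auto
  have all_y: "y (s * m + Suc j) = ybar (s * m + Suc j)" if "s \<le> S" "j < m" for s j
    using step(1)[OF that] inner[OF that(1), of j] outer[of s] that by auto

  have "m > 0"
    using assms(1,2) by (simp add: m_def)
  \<comment> \<open>Inner iterations are numbered from 1 to m, so \<open>k - 1\<close> is divided by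
    m: a positive multiple of m is the last step of an outer iteration, not the start of the
    next.\<close>
  have index: "\<exists>s j. s \<le> S \<and> j < m \<and> k = s * m + Suc j" if "k \<in> {1..Suc S * m}" for k
  proof (intro exI conjI)
    have "k - 1 < Suc S * m"
      using that by auto
    then have "(k - 1) div m < Suc S"
      by (rule less_mult_imp_div_less)
    then show "(k - 1) div m \<le> S"
      by simp
    show "(k - 1) mod m < m"
      using \<open>m > 0\<close> by simp
    show "k = (k - 1) div m * m + Suc ((k - 1) mod m)"
      using that by simp
  qed
  have "x k = xbar k \<and> z k = zbar k" if "k \<le> Suc S * m" for k
  \<comment> \<open>Index 0 precedes every inner iteration and is covered by the initial state
    alone.\<close>
  proof (cases "k = 0")
    case True
    then show ?thesis using outer[of 0] by simp
  next
    case False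
    then have "k \<in> {1..Suc S * m}"
      using that by simp
    then obtain s j where "s \<le> S" "j < m" "k = s * m + Suc j"
      using index by blast
    then show ?thesis using all[of s "Suc j"] by simp
  qed
  moreover have "y k = ybar k" if "k \<in> {1..Suc S * m}" for k
    using index[OF that] all_y by blast
  ultimately show ?thesis
    unfolding m_def by blast
qed

end
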